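(* Let $I\subset\mathbb{R}$ be an interval with interior $I^{\circ}$, let $f:I^{\circ}\to\mathbb{R}$ be differentiable on $I^{\circ}$, and let $a,b\in I^{\circ}$ with $a<b$. Let $q>1$ and let $p$ be defined by $\frac1p+\frac1q=1$. If $|f'|^{q}$ is convex on $[a,b]$, then $$\left|f\left(\frac{a+b}{2}\right)-\frac{1}{b-a}\int_{a}^{b}f(x)\,dx\right|\leq(b-a)\left(\frac{2}{(p+1)(p+2)}\right)^{\frac1p}\left(\frac{|f'(a)|^{q}+|f'(b)|^{q}}{2}\right)^{\frac1q}.$$
   Context: A function $g:[a,b]\to\mathbb{R}$ is convex if $g(tx+(1-t)y)\leq t g(x)+(1-t)g(y)$ for all $x,y\in[a,b]$ and $t\in[0,1]$. *)

theory Defs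
  imports "HOL-Analysis.Analysis"
begin

end

theory Submission imports Defs begin

text \<open>
  Let m be the midpoint of [a, b] and M = (\<bar>f'(a)\<bar>^q + \<bar>f'(b)\<bar>^q) / 2. By convexity
  \<bar>f'\<bar>^q lies below its chord, whose value at m is M; since y \<mapsto> y^(1/q) lies below
  its tangent at M, it follows that \<bar>f'(x)\<bar> \<le> M^(1/q) + s (x - m) for some constant s.
  Integrating twice, the terms containing s cancel by symmetry about m, which gives the
  bound (b - a) / 4 * M^(1/q). The stated constant is weaker, because
  (p + 1) (p + 2) \<le> 2 (p + 1)^2 \<le> 2 * 4^p.
\<close>

text \<open>Both \<open>H - f\<close> and \<open>H + f\<close> have nonnegative derivative, hence
  are nondecreasing. Arguing by monotonicity avoids integrating \<open>f'\<close>, about whose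
  integrability nothing is assumed here.\<close>

lemma abs_diff_le_of_abs_deriv_le:
  fixes f f' H h :: "real \<Rightarrow> real"
  assumes "x \<le> y"
    and f: "\<And>z. z \<in> {x..y} \<Longrightarrow> (f has_real_derivative f' z) (at z)"
    and H: "\<And>z. z \<in> {x..y} \<Longrightarrow> (H has_real_derivative h z) (at z)"
    and le: "\<And>z. z \<in> {x..y} \<Longrightarrow> \<bar>f' z\<bar> \<le> h z"
  shows "\<bar>f y - f x\<bar> \<le> H y - H x"
proof -
  have "(\<lambda>z. H z - f z) x \<le> (\<lambda>z. H z - f z) y"
  proof (rule DERIV_nonneg_imp_nondecreasing[OF \<open>x \<le> y\<close>])
    fix z assume "x \<le> z" "z \<le> y"
    then have z: "z \<in> {x..y}" by simp
    show "\<exists>d. ((\<lambda>z. H z - f z) has_real_derivative d) (at z) \<and> 0 \<le> d"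
      using DERIV_diff[OF H[OF z] f[OF z]] le[OF z] by (intro exI[of _ "h z - f' z"]) auto
  qed
  moreover have "(\<lambda>z. H z + f z) x \<le> (\<lambda>z. H z + f z) y"
  proof (rule DERIV_nonneg_imp_nondecreasing[OF \<open>x \<le> y\<close>])
    fix z assume "x \<le> z" "z \<le> y"
    then have z: "z \<in> {x..y}" by simp
    show "\<exists>d. ((\<lambda>z. H z + f z) has_real_derivative d) (at z) \<and> 0 \<le> d"
      using DERIV_add[OF H[OF z] f[OF z]] le[OF z] by (intro exI[of _ "h z + f' z"]) auto
  qed
  ultimately show ?thesis by (simp add: abs_le_iff)
qed

text \<open>With m the midpoint, the left-hand side is the absolute value of the mean of f x - f m
  over [a, b]. So it suffices to bound f x - f m on each half, by integrating the derivative bound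
  outwards from m.\<close>

lemma midpoint_error_le:
  fixes f f' :: "real \<Rightarrow> real"
  assumes "a < b"
    and f: "\<And>x. x \<in> {a..b} \<Longrightarrow> (f has_real_derivative f' x) (at x)"
    and le: "\<And>x. x \<in> {a..b} \<Longrightarrow> \<bar>f' x\<bar> \<le> c + s * (x - (a + b) / 2)"
  shows "\<bar>f ((a + b) / 2) - 1 / (b - a) * integral {a..b} f\<bar> \<le> (b - a) / 4 * c"
proof -
  define m where "m = (a + b) / 2"
  define d where "d = (b - a) / 2"
  have ab: "a = m - d" "b = m + d" and "0 < d"
    using \<open>a < b\<close> by (auto simp: m_def d_def field_simps)
  \<comment> \<open>\<open>H\<close> is the antiderivative of the bound on \<bar>f'\<bar>, and
    \<open>K\<close> that of \<open>H\<close>, both normalised to vanish at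
    \<open>m\<close>.\<close>
  define H where "H x = c * (x - m) + s * (x - m)^2 / 2" for x
  define K where "K x = c * (x - m)^2 / 2 + s * (x - m)^3 / 6" for x
  have dH: "(H has_real_derivative c + s * (x - m)) (at x)" for x
    unfolding H_def by (auto intro!: derivative_eq_intros)
  have dK: "(K has_real_derivative H x) (at x within S)" for x S
    unfolding K_def H_def by (auto intro!: derivative_eq_intros simp: field_simps power2_eq_square)
  have diff: "\<bar>f y - f x\<bar> \<le> H y - H x" if "a \<le> x" "x \<le> y" "y \<le> b" for x y
    using that le by (intro abs_diff_le_of_abs_deriv_le[OF _ f dH]) (auto simp: m_def)
  have cont: "continuous_on {a..b} f"
    using f by (intro continuous_at_imp_continuous_on ballI) (rule DERIV_isCont)
  have intH: "(H has_integral K y - K x) {x..y}" if "x \<le> y" for x y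
    using dK by (intro fundamental_theorem_of_calculus that)
      (auto simp: has_real_derivative_iff_has_vector_derivative)
  have intf: "(\<lambda>x. f x - f m) integrable_on {x..y}" if "a \<le> x" "y \<le> b" for x y
    using that cont
    by (intro integrable_continuous_real continuous_intros) (auto intro: continuous_on_subset)
  have [simp]: "H m = 0" "K m = 0" by (auto simp: H_def K_def)
  have right: "\<bar>integral {m..b} (\<lambda>x. f x - f m)\<bar> \<le> K b"
  proof -
    have "norm (integral {m..b} (\<lambda>x. f x - f m)) \<le> integral {m..b} H"
      using diff[of m] intH[of m b] \<open>0 < d\<close>
      by (intro integral_norm_bound_integral intf) (auto simp: ab has_integral_integrable)
    also have "\<dots> = K b" using integral_unique[OF intH[of m b]] \<open>0 < d\<close> by (simp add: ab)
    finally show ?thesis by simp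
  qed
  have left: "\<bar>integral {a..m} (\<lambda>x. f x - f m)\<bar> \<le> K a"
  proof -
    \<comment> \<open>To the left of \<open>m\<close> the bound on \<bar>f x - f m\<bar> is H m - H
      x = - H x, whose integral over [a, m] is - (K m - K a) = K a.\<close>
    have i: "((\<lambda>x. - H x) has_integral K a) {a..m}"
      using has_integral_neg[OF intH[of a m]] \<open>0 < d\<close> by (simp add: ab)
    have "norm (integral {a..m} (\<lambda>x. f x - f m)) \<le> integral {a..m} (\<lambda>x. - H x)"
      using diff[of _ m] i \<open>0 < d\<close>
      by (intro integral_norm_bound_integral intf)
        (auto simp: ab abs_minus_commute has_integral_integrable)
    also have "\<dots> = K a" by (rule integral_unique[OF i])
    finally show ?thesis by simp
  qed
  have "integral {a..b} (\<lambda>x. f x - f m) = integral {a..b} f - (b - a) * f m"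
    using \<open>a < b\<close> integrable_continuous_real[OF cont] by (subst integral_diff) auto
  moreover have "integral {a..m} (\<lambda>x. f x - f m) + integral {m..b} (\<lambda>x. f x - f m)
      = integral {a..b} (\<lambda>x. f x - f m)"
    using \<open>0 < d\<close> by (intro Henstock_Kurzweil_Integration.integral_combine intf) (auto simp: ab)
  \<comment> \<open>The even quadratic terms add up, while the odd cubic terms, which carry
    \<open>s\<close>, cancel.\<close>
  moreover have "K a + K b = c * d^2" by (simp add: K_def ab)
  ultimately have "\<bar>integral {a..b} f - (b - a) * f m\<bar> \<le> c * d^2"
    using left right by linarith
  moreover have "\<bar>f m - 1 / (b - a) * integral {a..b} f\<bar>
      = \<bar>integral {a..b} f - (b - a) * f m\<bar> / (b - a)"
  proof -
    have "f m - 1 / (b - a) * integral {a..b} f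
        = - ((integral {a..b} f - (b - a) * f m) / (b - a))"
      using \<open>a < b\<close> by (simp add: field_simps)
    then show ?thesis using \<open>a < b\<close> by simp
  qed
  ultimately have "\<bar>f m - 1 / (b - a) * integral {a..b} f\<bar> \<le> c * d^2 / (b - a)"
    using \<open>a < b\<close> by (simp add: divide_right_mono)
  also have "\<dots> = (b - a) / 4 * c"
    using \<open>0 < d\<close> by (simp add: ab power2_eq_square)
  finally show ?thesis unfolding m_def .
qed

text \<open>Multiplied by y^(1 - r), the tangent inequality becomes Young's inequality x^r y^(1 - r)
  \<le> r x + (1 - r) y.\<close>

lemma powr_le_tangent:
  fixes r x y :: real
  assumes r: "0 \<le> r" "r \<le> 1" and "0 < y" and "0 \<le> x"
  shows "x powr r \<le> y powr r + r * y powr (r - 1) * (x - y)"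
proof -
  have pos: "0 < y powr (1 - r)" and "y powr (1 - r) * y powr (r - 1) = 1"
    and "y powr (1 - r) * y powr r = y"
    using \<open>0 < y\<close> by (auto simp flip: powr_add)
  then have eq: "y powr (1 - r) * (y powr r + r * y powr (r - 1) * (x - y)) = r * x + (1 - r) * y"
    by algebra
  have "y powr (1 - r) * x powr r \<le> r * x + (1 - r) * y"
  \<comment> \<open>Young's inequality is applied to positive \<open>x\<close> only. At
    \<open>x = 0\<close> the left-hand side vanishes, even for \<open>r = 0\<close>, because
    \<open>0 powr 0 = 0\<close>.\<close>
  proof (cases "x = 0")
    case True
    then show ?thesis using assms by simp
  next
    case False
    then show ?thesis
      using Youngs_inequality_0[of r "1 - r" x y] assms by (simp add: mult.commute)
  qed
  then show ?thesis using pos unfolding eq[symmetric] by (simp add: mult_le_cancel_left_pos)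
qed

text \<open>The tangent to t^(1/p) at 1 takes the value 1 + (1/p) p = 2 at t = 1 + p; raising to the
  power p gives the claim.\<close>

lemma one_plus_le_two_powr:
  fixes p :: real
  assumes "1 \<le> p"
  shows "1 + p \<le> 2 powr p"
proof -
  have "(1 + p) powr (1 / p) \<le> 2"
    using powr_le_tangent[of "1 / p" 1 "1 + p"] assms by simp
  then have "((1 + p) powr (1 / p)) powr p \<le> 2 powr p"
    using assms by (intro powr_mono2) auto
  then show ?thesis using assms by (simp add: powr_powr)
qed

text \<open>Lets the factor 1/4 of \<open>midpoint_error_le\<close> be replaced by the constant of
  the theorem. Raised to the power p, the claim is (p + 1) (p + 2) \<le> 2 * 4^p.\<close>

lemma quarter_le_midpoint_constant:
  fixes p :: real
  assumes "1 \<le> p"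
  shows "1 / 4 \<le> (2 / ((p + 1) * (p + 2))) powr (1 / p)"
proof -
  have "(p + 1) * (p + 2) \<le> 2 * (1 + p)^2"
    using assms by (simp add: power2_eq_square algebra_simps)
  also have "\<dots> \<le> 2 * (2 powr p)^2"
    using one_plus_le_two_powr[OF assms] assms by (intro mult_left_mono power_mono) auto
  also have "(2 powr p)^2 = (4::real) powr p"
    using powr_mult[of 2 2 p] by (simp add: power2_eq_square)
  finally have "1 / 4 powr p * ((p + 1) * (p + 2)) \<le> 2"
    by (simp add: divide_le_eq)
  then have "1 / 4 powr p \<le> 2 / ((p + 1) * (p + 2))"
    using assms by (subst pos_le_divide_eq) auto
  then have "(1 / 4 powr p) powr (1 / p) \<le> (2 / ((p + 1) * (p + 2))) powr (1 / p)"
    using assms by (intro powr_mono2) auto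
  then show ?thesis using assms by (simp add: powr_divide powr_powr)
qed

text \<open>The chord is expanded about the midpoint, so that its constant term is the mean of the
  endpoint values and the rest is odd about the midpoint.\<close>

lemma convex_on_le_chord_midpoint:
  fixes g :: "real \<Rightarrow> real"
  assumes "convex_on {a..b} g" "a < b" "x \<in> {a..b}"
  shows "g x \<le> (g a + g b) / 2 + (g b - g a) / (b - a) * (x - (a + b) / 2)"
proof -
  have "g x \<le> (g b - g a) / (b - a) * (x - a) + g a"
    using assms by (intro convex_onD_Icc') auto
  also have "\<dots> = (g a + g b) / 2 + (g b - g a) / (b - a) * (x - (a + b) / 2)"
    using \<open>a < b\<close> by (simp add: divide_simps) algebra
  finally show ?thesis .
qed

theorem theorem3:
  fixes f :: "real \<Rightarrow> real" and I :: "real set" and a b p q :: real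
  assumes "is_interval I"
    and "f differentiable_on interior I"
    and "a \<in> interior I" and "b \<in> interior I" and "a < b"
    and "q > 1" and "1 / p + 1 / q = 1"
    and "convex_on {a..b} (\<lambda>x. \<bar>deriv f x\<bar> powr q)"
  shows "\<bar>f ((a + b) / 2) - 1 / (b - a) * integral {a..b} f\<bar>
    \<le> (b - a) * (2 / ((p + 1) * (p + 2))) powr (1 / p)
        * ((\<bar>deriv f a\<bar> powr q + \<bar>deriv f b\<bar> powr q) / 2) powr (1 / q)"
proof -
  define g where "g x = \<bar>deriv f x\<bar> powr q" for x
  define M where "M = (g a + g b) / 2"
  define k where "k = (g b - g a) / (b - a)"
  \<comment> \<open>Chain rule: the derivative of t^(1/q) at \<open>M\<close> times the slope
    \<open>k\<close> of the chord.\<close>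
  define s where "s = 1 / q * M powr (1 / q - 1) * k"
  have "is_interval (interior I)"
    using \<open>is_interval I\<close> by (simp add: is_interval_convex_1)
  then have sub: "{a..b} \<subseteq> interior I"
    by (intro subsetI mem_is_interval_1_I[OF _ assms(3,4)]) auto
  have deriv: "(f has_real_derivative deriv f x) (at x)" if "x \<in> {a..b}" for x
  proof -
    have "x \<in> interior I" using that sub by blast
    \<comment> \<open>As the interior is open, differentiability within it is two-sided, also at the
      endpoints \<open>a\<close> and \<open>b\<close>.\<close>
    then have "f differentiable at x"
      using assms(2) by (auto simp: differentiable_on_def at_within_open[OF _ open_interior])
    then show ?thesis
      by (simp add: DERIV_deriv_iff_real_differentiable)
  qed
  have g_nonneg: "0 \<le> g x" for x by (simp add: g_def)
  have bound: "\<bar>deriv f x\<bar> \<le> M powr (1 / q) + s * (x - (a + b) / 2)" if "x \<in> {a..b}" for x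
  proof -
    define l where "l = M + k * (x - (a + b) / 2)"
    have "g x \<le> l"
      using convex_on_le_chord_midpoint[OF assms(8,5) that] by (simp add: l_def M_def k_def g_def)
    have "\<bar>deriv f x\<bar> = g x powr (1 / q)"
      using \<open>q > 1\<close> by (simp add: g_def powr_powr)
    also have "\<dots> \<le> l powr (1 / q)"
      using \<open>g x \<le> l\<close> g_nonneg \<open>q > 1\<close> by (intro powr_mono2) auto
    also have "\<dots> \<le> M powr (1 / q) + s * (x - (a + b) / 2)"
    \<comment> \<open>For \<open>M = 0\<close> there is no tangent to use, but then \<open>g\<close>
      vanishes at both endpoints, the chord is zero, and both sides are 0.\<close>
    proof (cases "M = 0")
      case True
      then have "g a = 0" "g b = 0" using g_nonneg[of a] g_nonneg[of b] by (auto simp: M_def)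
      then show ?thesis using True by (simp add: l_def s_def k_def)
    next
      case False
      then have "0 < M" using g_nonneg[of a] g_nonneg[of b] by (simp add: M_def)
      moreover have "0 \<le> l" using \<open>g x \<le> l\<close> g_nonneg[of x] by linarith
      ultimately show ?thesis
        using powr_le_tangent[of "1 / q" M l] \<open>q > 1\<close> by (simp add: l_def s_def mult_ac)
    qed
    finally show ?thesis .
  qed
  have "1 / p = 1 - 1 / q" using assms(7) by simp
  then have "0 < 1 / p" "1 / p < 1" using \<open>q > 1\<close> by auto
  \<comment> \<open>Positivity of \<open>1 / p\<close> excludes negative \<open>p\<close>, and also
    \<open>p = 0\<close>, where \<open>1 / p\<close> is 0 by convention.\<close>
  then have "1 \<le> p" by (auto simp: divide_less_eq zero_less_divide_iff split: if_splits)
  have "\<bar>f ((a + b) / 2) - 1 / (b - a) * integral {a..b} f\<bar> \<le> (b - a) / 4 * M powr (1 / q)"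
    by (rule midpoint_error_le[OF \<open>a < b\<close> deriv bound])
  also have "\<dots> = (b - a) * (1 / 4) * M powr (1 / q)" by simp
  also have "\<dots> \<le> (b - a) * (2 / ((p + 1) * (p + 2))) powr (1 / p) * M powr (1 / q)"
    using \<open>a < b\<close> quarter_le_midpoint_constant[OF \<open>1 \<le> p\<close>]
    by (intro mult_right_mono mult_left_mono) auto
  finally show ?thesis unfolding M_def g_def .
qed

end
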